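(* Let $k\ge 0$, let $U$ be a domain in $\mathbb{R}^n$, and let $g:U\times\mathbb{R}^n\to Cl_{n+1}$ be such that for each $x\in U$ the function $u\mapsto g(x,u)$ is a left monogenic polynomial homogeneous of degree $k$ in $u$. Then for every $x_s\in C(U)$, with $x:=C^{-1}(x_s)\in U$, $$P_{k,w}\,J(C^{-1},x_s)\,g\Big(C^{-1}(x_s),\frac{(x_s-e_{n+1})w(x_s-e_{n+1})}{\|x_s-e_{n+1}\|^2}\Big)=J(C^{-1},x_s)\,P_{k,u}g(x,u),$$ where $u=\dfrac{(x_s-e_{n+1})w(x_s-e_{n+1})}{\|x_s-e_{n+1}\|^2}\in\mathbb{R}^n$ and $J(C^{-1},x_s)=\dfrac{x_s-e_{n+1}}{\|x_s-e_{n+1}\|^n}$.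
   Context: $Cl_{n+1}$ is the real Clifford algebra generated by $\mathbb{R}^{n+1}$ with orthonormal basis $e_1,\dots,e_{n+1}$ and relations $e_ie_j+e_je_i=-2\delta_{ij}$; $\mathbb{R}^n=\mathrm{span}(e_1,\dots,e_n)\subset\mathbb{R}^{n+1}\subset Cl_{n+1}$, and products of vectors are Clifford products. $\mathbb{S}^n$ is the unit sphere of $\mathbb{R}^{n+1}$. The Cayley transformation is $C:\mathbb{R}^n\to\mathbb{S}^n\setminus\{e_{n+1}\}$, $C(x)=(e_{n+1}x+1)(x+e_{n+1})^{-1}$, with inverse $C^{-1}(x_s)=(-e_{n+1}x_s+1)(x_s-e_{n+1})^{-1}$. Let $H$ be an $n$-dimensional linear subspace of $\mathbb{R}^{n+1}$ with orthonormal basis $\varepsilon_1,\dots,\varepsilon_n$. Its Dirac operator is $D_H=\sum_j\varepsilon_j\partial_{\varepsilon_j}$ (independent of the basis). $\mathcal{H}_k(H)$ is the space of $Cl_{n+1}$-valued harmonic polynomials on $H$ homogeneous of degree $k$, and $\mathcal{M}_k(H)$ is the space of $Cl_{n+1}$-valued polynomials $p$ on $H$ homogeneous of degree $k$ with $D_Hp=0$ (left monogenic); $\mathcal{M}_{-1}(H)=0$. The Almansi-Fischer decomposition is $\mathcal{H}_k(H)=\mathcal{M}_k(H)\oplus w\,\mathcal{M}_{k-1}(H)$, $w\in H$ the variable; the projection $P_k:\mathcal{H}_k(H)\to\mathcal{M}_k(H)$ is taken along this decomposition. For $H=\mathbb{R}^n$ with variable $u$ it is written $P_{k,u}$. "Left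 monogenic in $u$" means in $\mathcal{M}_k(\mathbb{R}^n)$. For fixed $x_s\in\mathbb{S}^n\setminus\{e_{n+1}\}$ put $a=\frac{x_s-e_{n+1}}{\|x_s-e_{n+1}\|}$, a unit vector. The variable $w$ ranges over the hyperplane $a\mathbb{R}^na=\{w\in\mathbb{R}^{n+1}:awa\in\mathbb{R}^n\}$ of $\mathbb{R}^{n+1}$, and $P_{k,w}$ is the projection for $H=a\mathbb{R}^na$, applied to the displayed expression as a function of $w$ with $x_s$ fixed. *)

theory Defs
  imports "HOL-Analysis.Analysis"
begin

section \<open>The real Clifford algebra on an orthonormal set of generators\<close>

text \<open>
  The generators are indexed by a finite type. An element is given by its coefficients with
  respect to the blades \<open>e\<^sub>A = e\<^bsub>i\<^sub>1\<^esub> \<cdots> e\<^bsub>i\<^sub>r\<^esub>\<close>, where \<open>A = {i\<^sub>1 < \<dots> < i\<^sub>r}\<close> and the indices are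
  ordered through the injection \<^term>\<open>to_nat\<close>.
\<close>

typedef 'i clifford = "UNIV :: ('i set \<Rightarrow> real) set"
  morphisms coeff Clifford
  by simp

lemma coeff_Clifford [simp]: "coeff (Clifford f) = f"
  by (simp add: Clifford_inverse)

lemma clifford_eq_iff: "x = y \<longleftrightarrow> (\<forall>A. coeff x A = coeff y A)"
  by (metis coeff_inject ext)

definition blade :: "'i set \<Rightarrow> 'i clifford" where
  "blade A = Clifford (\<lambda>B. if B = A then 1 else 0)"

lemma coeff_blade: "coeff (blade A) B = (if B = A then 1 else 0)"
  by (simp add: blade_def)

lemma blade_eq_iff: "blade A = blade B \<longleftrightarrow> A = B"
  by (metis coeff_blade zero_neq_one)

text \<open>
  Sorting the product \<open>e\<^sub>A e\<^sub>B\<close> gives \<open>\<plusminus> e\<^sub>C\<close>, with \<open>C\<close> the symmetric difference of \<open>A\<close> and \<open>B\<close>.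
  The sign collects a factor \<open>-1\<close> for every pair \<open>a \<in> A\<close>, \<open>b \<in> B\<close> with \<open>b < a\<close> (these anticommute)
  and for every pair with \<open>b = a\<close> (as \<open>e\<^sub>a\<close> squares to \<open>-1\<close>).
\<close>

definition blade_sign :: "'i::finite set \<Rightarrow> 'i set \<Rightarrow> real" where
  "blade_sign A B = (\<Prod>a\<in>A. \<Prod>b\<in>B. if to_nat b \<le> to_nat a then - 1 else 1)"

instantiation clifford :: (type) real_vector
begin

definition "0 = Clifford (\<lambda>A. 0)"
definition "x + y = Clifford (\<lambda>A. coeff x A + coeff y A)"
definition "x - y = Clifford (\<lambda>A. coeff x A - coeff y A)"
definition "- x = Clifford (\<lambda>A. - coeff x A)"
definition "r *\<^sub>R x = Clifford (\<lambda>A. r * coeff x A)"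

instance
  by standard (simp_all add: clifford_eq_iff zero_clifford_def plus_clifford_def
    minus_clifford_def uminus_clifford_def scaleR_clifford_def algebra_simps)

end

lemma coeff_zero [simp]: "coeff 0 A = 0"
  and coeff_add [simp]: "coeff (x + y) A = coeff x A + coeff y A"
  and coeff_diff [simp]: "coeff (x - y) A = coeff x A - coeff y A"
  and coeff_minus [simp]: "coeff (- x) A = - coeff x A"
  and coeff_scaleR [simp]: "coeff (r *\<^sub>R x) A = r * coeff x A"
  by (simp_all add: zero_clifford_def plus_clifford_def
    minus_clifford_def uminus_clifford_def scaleR_clifford_def)

text \<open>The inner product makes the blades orthonormal; on vectors it is the Euclidean one.\<close>

instantiation clifford :: (finite) real_inner
begin

definition inner_clifford :: "'a clifford \<Rightarrow> 'a clifford \<Rightarrow> real" where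
  "inner_clifford x y = (\<Sum>A\<in>UNIV. coeff x A * coeff y A)"
definition norm_clifford :: "'a clifford \<Rightarrow> real" where
  "norm_clifford x = sqrt (inner x x)"
definition dist_clifford :: "'a clifford \<Rightarrow> 'a clifford \<Rightarrow> real" where
  "dist_clifford x y = norm (x - y)"
definition sgn_clifford :: "'a clifford \<Rightarrow> 'a clifford" where
  "sgn_clifford x = x /\<^sub>R norm x"
definition uniformity_clifford :: "('a clifford \<times> 'a clifford) filter" where
  "uniformity_clifford = (INF e\<in>{0 <..}. principal {(x, y). dist x y < e})"
definition open_clifford :: "'a clifford set \<Rightarrow> bool" where
  "open_clifford U = (\<forall>x\<in>U. eventually (\<lambda>(x', y). x' = x \<longrightarrow> y \<in> U) uniformity)"

instance
proof
  fix x y z :: "'a clifford" and r :: real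
  show "inner x y = inner y x"
    by (simp add: inner_clifford_def mult.commute)
  show "inner (x + y) z = inner x z + inner y z"
    by (simp add: inner_clifford_def algebra_simps sum.distrib)
  show "inner (r *\<^sub>R x) y = r * inner x y"
    by (simp add: inner_clifford_def algebra_simps sum_distrib_left)
  show "0 \<le> inner x x"
    by (simp add: inner_clifford_def sum_nonneg)
  show "inner x x = 0 \<longleftrightarrow> x = 0"
    by (simp add: inner_clifford_def clifford_eq_iff sum_nonneg_eq_0_iff)
qed (simp_all add: norm_clifford_def dist_clifford_def sgn_clifford_def
       uniformity_clifford_def open_clifford_def)

end

lemma inner_blade: "inner x (blade A) = coeff x A"
  by (simp add: inner_clifford_def coeff_blade if_distrib sum.delta cong: if_cong)

instantiation clifford :: (finite) euclidean_space
begin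

definition "Basis = range blade"

instance
proof
  show "(Basis :: 'a clifford set) \<noteq> {}" "finite (Basis :: 'a clifford set)"
    by (simp_all add: Basis_clifford_def)
  fix u v :: "'a clifford"
  assume "u \<in> Basis" "v \<in> Basis"
  then obtain A B where "u = blade A" "v = blade B"
    by (auto simp: Basis_clifford_def)
  then show "inner u v = (if u = v then 1 else 0)"
    by (auto simp: inner_blade coeff_blade blade_eq_iff)
next
  fix x :: "'a clifford"
  show "(\<forall>u\<in>Basis. inner x u = 0) \<longleftrightarrow> x = 0"
    by (simp add: Basis_clifford_def inner_blade clifford_eq_iff)
qed

end

lemma prod_sym_diff:
  fixes h :: "'i \<Rightarrow> real"
  assumes "finite A" "finite B" "\<And>i. h i * h i = 1"
  shows "prod h (sym_diff A B) = prod h A * prod h B"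
proof -
  have A: "prod h A = prod h (A - B) * prod h (A \<inter> B)"
    using assms prod.Int_Diff[of A h B] by (simp add: mult.commute)
  have B: "prod h B = prod h (B - A) * prod h (A \<inter> B)"
    using assms prod.Int_Diff[of B h A] by (simp add: mult.commute Int_commute)
  have I: "prod h (A \<inter> B) * prod h (A \<inter> B) = 1"
    by (simp add: assms prod.distrib[symmetric])
  have "prod h (sym_diff A B) = prod h (A - B) * prod h (B - A)"
    using assms by (intro prod.union_disjoint) auto
  also have "\<dots> = prod h (A - B) * prod h (B - A) * (prod h (A \<inter> B) * prod h (A \<inter> B))"
    by (simp add: I)
  finally show ?thesis
    unfolding A B by (simp add: algebra_simps)
qed

lemma blade_sign_square: "blade_sign A B * blade_sign A B = 1"
proof -
  have "blade_sign A B * blade_sign A B =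
      (\<Prod>a\<in>A. \<Prod>b\<in>B. (if to_nat b \<le> to_nat a then - 1 else 1) * (if to_nat b \<le> to_nat a then - 1 else 1))"
    by (simp only: blade_sign_def prod.distrib)
  also have "\<dots> = 1"
    by (intro prod.neutral ballI) simp
  finally show ?thesis .
qed

lemma blade_sign_sym_diff_right:
  "blade_sign A (sym_diff B C) = blade_sign A B * blade_sign A C"
  by (simp add: blade_sign_def prod_sym_diff prod.distrib)

lemma blade_sign_sym_diff_left:
  "blade_sign (sym_diff A B) C = blade_sign A C * blade_sign B C"
  unfolding blade_sign_def
  by (rule prod_sym_diff) (auto simp: prod.distrib[symmetric] intro!: prod.neutral)

lemma blade_sign_empty [simp]: "blade_sign {} A = 1" "blade_sign A {} = 1"
  by (simp_all add: blade_sign_def)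

text \<open>
  The coefficient of \<open>e\<^sub>C\<close> in a product collects the products \<open>e\<^sub>A e\<^sub>B\<close> for which \<open>C\<close> is the
  symmetric difference of \<open>A\<close> and \<open>B\<close>, that is, \<open>B\<close> that of \<open>A\<close> and \<open>C\<close>.
\<close>

instantiation clifford :: (finite) real_algebra_1
begin

definition one_clifford :: "'a clifford" where
  "1 = blade {}"
definition times_clifford :: "'a clifford \<Rightarrow> 'a clifford \<Rightarrow> 'a clifford" where
  "x * y = Clifford (\<lambda>C. \<Sum>A\<in>UNIV.
     blade_sign A (sym_diff A C) * coeff x A * coeff y (sym_diff A C))"

instance
proof
  fix x y z :: "'a clifford" and r :: real
  show "(x + y) * z = x * z + y * z" "x * (y + z) = x * y + x * z"
    by (simp_all add: times_clifford_def clifford_eq_iff algebra_simps sum.distrib)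
  show "(r *\<^sub>R x) * y = r *\<^sub>R (x * y)" "x * (r *\<^sub>R y) = r *\<^sub>R (x * y)"
    by (simp_all add: times_clifford_def clifford_eq_iff algebra_simps sum_distrib_left)
  show "(0 :: 'a clifford) \<noteq> 1"
    by (auto simp: one_clifford_def clifford_eq_iff coeff_blade)
  show "1 * x = x"
  proof -
    have "(\<Sum>A\<in>UNIV. blade_sign A (sym_diff A C) * coeff 1 A * coeff x (sym_diff A C)) =
        (\<Sum>A\<in>(UNIV :: 'a set set). if A = {} then coeff x C else 0)" for C
    proof (rule sum.cong[OF refl])
      fix A :: "'a set"
      show "blade_sign A (sym_diff A C) * coeff 1 A * coeff x (sym_diff A C) =
          (if A = {} then coeff x C else 0)"
        by (simp add: one_clifford_def coeff_blade)
    qed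
    then show ?thesis
      by (simp add: times_clifford_def clifford_eq_iff)
  qed
  show "x * 1 = x"
  proof -
    have "(\<Sum>A\<in>UNIV. blade_sign A (sym_diff A C) * coeff x A * coeff 1 (sym_diff A C)) =
        (\<Sum>A\<in>UNIV. if A = C then coeff x C else 0)" for C
    proof (intro sum.cong refl)
      fix A :: "'a set"
      have "sym_diff A C = {} \<longleftrightarrow> A = C"
        by blast
      then show "blade_sign A (sym_diff A C) * coeff x A * coeff 1 (sym_diff A C) =
          (if A = C then coeff x C else 0)"
        by (simp add: one_clifford_def coeff_blade)
    qed
    then show ?thesis
      by (simp add: times_clifford_def clifford_eq_iff)
  qed
  show "(x * y) * z = x * (y * z)"
    unfolding clifford_eq_iff
  proof
    fix D
    have "coeff ((x * y) * z) D = (\<Sum>A\<in>UNIV. \<Sum>B\<in>UNIV.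
        blade_sign A (sym_diff A D) * blade_sign B (sym_diff B A) *
        coeff x B * coeff y (sym_diff B A) * coeff z (sym_diff A D))"
      by (simp add: times_clifford_def sum_distrib_left sum_distrib_right mult_ac)
    also have "\<dots> = (\<Sum>B\<in>UNIV. \<Sum>A\<in>UNIV.
        blade_sign A (sym_diff A D) * blade_sign B (sym_diff B A) *
        coeff x B * coeff y (sym_diff B A) * coeff z (sym_diff A D))"
      by (rule sum.swap)
    also have "\<dots> = (\<Sum>B\<in>UNIV. \<Sum>C\<in>UNIV.
        blade_sign B (sym_diff B D) * blade_sign C (sym_diff C (sym_diff B D)) *
        coeff x B * coeff y C * coeff z (sym_diff C (sym_diff B D)))"
    proof (rule sum.cong[OF refl])
      fix B :: "'a set"
      have inv: "sym_diff B (sym_diff B A) = A" for A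
        by blast
      have bij: "bij_betw (sym_diff B) UNIV UNIV"
        by (intro bij_betwI[where g = "sym_diff B"]) (auto simp: inv)
      show "(\<Sum>A\<in>UNIV.
          blade_sign A (sym_diff A D) * blade_sign B (sym_diff B A) *
          coeff x B * coeff y (sym_diff B A) * coeff z (sym_diff A D)) =
        (\<Sum>C\<in>UNIV.
          blade_sign B (sym_diff B D) * blade_sign C (sym_diff C (sym_diff B D)) *
          coeff x B * coeff y C * coeff z (sym_diff C (sym_diff B D)))"
        unfolding sum.reindex_bij_betw[OF bij, symmetric,
          where g = "\<lambda>C. blade_sign B (sym_diff B D) * blade_sign C (sym_diff C (sym_diff B D)) *
            coeff x B * coeff y C * coeff z (sym_diff C (sym_diff B D))"]
      proof (rule sum.cong[OF refl])
        fix A :: "'a set"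
        have eq: "sym_diff (sym_diff B A) (sym_diff B D) = sym_diff A D"
          by blast
        have "blade_sign B (sym_diff B D) * blade_sign (sym_diff B A) (sym_diff A D) =
            blade_sign B D * blade_sign B D *
            (blade_sign A (sym_diff A D) * blade_sign B (sym_diff B A))"
          by (simp only: blade_sign_sym_diff_left blade_sign_sym_diff_right mult_ac)
        then show "blade_sign A (sym_diff A D) * blade_sign B (sym_diff B A) *
            coeff x B * coeff y (sym_diff B A) * coeff z (sym_diff A D) =
          blade_sign B (sym_diff B D) *
            blade_sign (sym_diff B A) (sym_diff (sym_diff B A) (sym_diff B D)) *
            coeff x B * coeff y (sym_diff B A) *
            coeff z (sym_diff (sym_diff B A) (sym_diff B D))"
          unfolding eq by (simp add: blade_sign_square)
      qed
    qed
    also have "\<dots> = coeff (x * (y * z)) D"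
      by (simp add: times_clifford_def sum_distrib_left mult_ac)
    finally show "coeff ((x * y) * z) D = coeff (x * (y * z)) D" .
  qed
qed

end

lemma blade_mult: "blade A * blade B = blade_sign A B *\<^sub>R blade (sym_diff A B)"
  unfolding clifford_eq_iff
proof
  fix C
  have "coeff (blade A * blade B) C =
      (\<Sum>A'\<in>UNIV. if A' = A then blade_sign A (sym_diff A C) * coeff (blade B) (sym_diff A C) else 0)"
    unfolding times_clifford_def coeff_Clifford
    by (rule sum.cong[OF refl]) (simp add: coeff_blade[of A])
  also have "\<dots> = blade_sign A (sym_diff A C) * coeff (blade B) (sym_diff A C)"
    by simp
  also have "\<dots> = coeff (blade_sign A B *\<^sub>R blade (sym_diff A B)) C"
  proof -
    have "sym_diff A C = B \<longleftrightarrow> C = sym_diff A B" "sym_diff A (sym_diff A B) = B"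
      by blast+
    then show ?thesis
      by (auto simp: coeff_blade simp del: Un_Diff)
  qed
  finally show "coeff (blade A * blade B) C = coeff (blade_sign A B *\<^sub>R blade (sym_diff A B)) C" .
qed

definition gen :: "'i \<Rightarrow> 'i clifford" where
  "gen i = blade {i}"

lemma gen_anticommute:
  "gen i * gen j + gen j * gen i = (if i = j then - 2 else 0 :: 'i::finite clifford)"
proof (cases "i = j")
  case True
  have "gen j * gen j = - (1 :: 'i clifford)"
    by (simp add: gen_def blade_mult blade_sign_def one_clifford_def)
  then have "gen j * gen j + gen j * gen j = - (1 + 1 :: 'i clifford)"
    by simp
  then show ?thesis
    using True by simp
next
  case False
  then have "to_nat i \<noteq> to_nat j" "sym_diff {j} {i} = sym_diff {i} {j}"
    by auto
  then show ?thesis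
    using False by (auto simp: gen_def blade_mult blade_sign_def)
qed

lemma gen_mult_blade:
  assumes "\<And>j. j \<in> A \<Longrightarrow> to_nat i < to_nat j"
  shows "gen i * blade A = (blade (insert i A) :: 'i::finite clifford)"
proof -
  have "i \<notin> A"
    using assms by blast
  moreover have "blade_sign {i} A = 1"
    using assms by (auto simp: blade_sign_def intro!: prod.neutral dest!: assms)
  ultimately show ?thesis
    by (simp add: gen_def blade_mult insert_Diff_if)
qed

definition cl_inverse :: "'i::finite clifford \<Rightarrow> 'i clifford" where
  "cl_inverse x = (THE y. x * y = 1 \<and> y * x = 1)"


section \<open>Vectors and the Cayley transformation\<close>

text \<open>
  With \<open>n = CARD('n)\<close>, the generators of \<open>Cl\<^bsub>n+1\<^esub>\<close> are indexed by \<^typ>\<open>'n option\<close>; the index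
  \<^term>\<open>None\<close> belongs to \<open>e\<^bsub>n+1\<^esub>\<close>. The spaces \<open>\<real>\<^sup>n \<subseteq> \<real>\<^bsup>n+1\<^esup>\<close> are subspaces of the algebra.
\<close>

abbreviation e_last :: "'n::finite option clifford" where
  "e_last \<equiv> gen None"

definition Rn :: "'n::finite option clifford set" where
  "Rn = span (range (\<lambda>i. gen (Some i)))"

definition Rn1 :: "'n::finite option clifford set" where
  "Rn1 = span (range gen)"

definition cayley :: "'n::finite option clifford \<Rightarrow> 'n option clifford" where
  "cayley x = (e_last * x + 1) * cl_inverse (x + e_last)"

definition cayley_inv :: "'n::finite option clifford \<Rightarrow> 'n option clifford" where
  "cayley_inv xs = (- e_last * xs + 1) * cl_inverse (xs - e_last)"

definition cayley_J :: "'n::finite option clifford \<Rightarrow> 'n option clifford" where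
  "cayley_J xs = (xs - e_last) /\<^sub>R norm (xs - e_last) ^ CARD('n)"

definition conj_Rn :: "'n::finite option clifford \<Rightarrow> 'n option clifford set" where
  "conj_Rn a = {w \<in> Rn1. a * w * a \<in> Rn}"


section \<open>Monogenic polynomials and the Almansi-Fischer projection\<close>

text \<open>
  A function on a subspace \<open>H\<close> is represented by an element of \<^term>\<open>extensional H\<close>, so that
  functions that agree on \<open>H\<close> are equal. The derivatives below are taken along \<open>H\<close> at points of
  \<open>H\<close>, and so depend on the values on \<open>H\<close> only.
\<close>

definition orthonormal_basis :: "'a::real_inner set \<Rightarrow> 'a set \<Rightarrow> bool" where
  "orthonormal_basis H B \<longleftrightarrow>
     B \<subseteq> H \<and> pairwise orthogonal B \<and> (\<forall>b\<in>B. norm b = 1) \<and> span B = H"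

definition some_basis :: "'a::real_inner set \<Rightarrow> 'a set" where
  "some_basis H = (SOME B. orthonormal_basis H B)"

lemma orthonormal_basis_some_basis:
  fixes H :: "'a::euclidean_space set"
  assumes "subspace H"
  shows "orthonormal_basis H (some_basis H)"
proof -
  obtain B where "B \<subseteq> H" "pairwise orthogonal B" "\<And>x. x \<in> B \<Longrightarrow> norm x = 1" "span B = H"
    using orthonormal_basis_subspace[OF assms] by metis
  then have "orthonormal_basis H B"
    by (simp add: orthonormal_basis_def)
  then show ?thesis
    unfolding some_basis_def by (rule someI)
qed

definition dir_deriv :: "'a::real_normed_vector \<Rightarrow> ('a \<Rightarrow> 'b::real_normed_vector) \<Rightarrow> 'a \<Rightarrow> 'b" where
  "dir_deriv v f x = vector_derivative (\<lambda>t. f (x + t *\<^sub>R v)) (at 0)"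

text \<open>
  For differentiable functions neither operator depends on the choice of the orthonormal basis.
\<close>

definition dirac ::
  "'i::finite clifford set \<Rightarrow> ('i clifford \<Rightarrow> 'i clifford) \<Rightarrow> 'i clifford \<Rightarrow> 'i clifford" where
  "dirac H f x = (\<Sum>b\<in>some_basis H. b * dir_deriv b f x)"

definition laplacian ::
  "'i::finite clifford set \<Rightarrow> ('i clifford \<Rightarrow> 'i clifford) \<Rightarrow> 'i clifford \<Rightarrow> 'i clifford" where
  "laplacian H f x = (\<Sum>b\<in>some_basis H. dir_deriv b (dir_deriv b f) x)"

text \<open>
  The polynomials on \<open>H\<close> are the restrictions of the polynomials on the whole (Euclidean) algebra.
\<close>

definition homogeneous_polys ::
  "'i::finite clifford set \<Rightarrow> nat \<Rightarrow> ('i clifford \<Rightarrow> 'i clifford) set" where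
  "homogeneous_polys H k = {f \<in> extensional H.
     (\<exists>p. polynomial_function p \<and> (\<forall>x\<in>H. f x = p x)) \<and>
     (\<forall>x\<in>H. \<forall>t::real. f (t *\<^sub>R x) = t ^ k *\<^sub>R f x)}"

definition harmonic_polys ::
  "'i::finite clifford set \<Rightarrow> nat \<Rightarrow> ('i clifford \<Rightarrow> 'i clifford) set" where
  "harmonic_polys H k = {f \<in> homogeneous_polys H k. \<forall>x\<in>H. laplacian H f x = 0}"

definition monogenic_polys ::
  "'i::finite clifford set \<Rightarrow> nat \<Rightarrow> ('i clifford \<Rightarrow> 'i clifford) set" where
  "monogenic_polys H k = {f \<in> homogeneous_polys H k. \<forall>x\<in>H. dirac H f x = 0}"

text \<open>The space of degree \<open>k - 1\<close>, which is zero for \<open>k = 0\<close>.\<close>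

definition monogenic_polys_pred ::
  "'i::finite clifford set \<Rightarrow> nat \<Rightarrow> ('i clifford \<Rightarrow> 'i clifford) set" where
  "monogenic_polys_pred H k = (case k of 0 \<Rightarrow> {\<lambda>x\<in>H. 0} | Suc j \<Rightarrow> monogenic_polys H j)"

definition fischer_proj ::
  "'i::finite clifford set \<Rightarrow> nat \<Rightarrow> ('i clifford \<Rightarrow> 'i clifford) \<Rightarrow> 'i clifford \<Rightarrow> 'i clifford" where
  "fischer_proj H k = (\<lambda>f\<in>harmonic_polys H k.
     THE p. p \<in> monogenic_polys H k \<and>
       (\<exists>q\<in>monogenic_polys_pred H k. f = (\<lambda>w\<in>H. p w + w * q w)))"

end

theory Submission
  imports Defs
begin

text \<open>
  A monogenic \<open>f\<close> is its own monogenic part, so \<open>P\<^sub>k f = f\<close>, and the theorem amounts to saying that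
  \<open>w \<mapsto> J(C\<^sup>-\<^sup>1, x\<^sub>s) g(x, a w a)\<close> is again monogenic, on the hyperplane \<open>a \<real>\<^sup>n a\<close>. Three facts
  carry this.

  The projection fixes monogenic polynomials (\<open>fischer_proj_monogenic\<close>). The projection is defined
  on harmonic polynomials, and monogenic polynomials are harmonic because \<open>D\<^sup>2 = - \<Delta>\<close>
  (\<open>dirac_dirac\<close>), as the derivatives of a polynomial commute. A decomposition of \<open>f\<close> is
  \<open>f = f + w 0\<close>, and it is the only one of the form \<open>f = p + w q\<close> because of \<open>D(w q) = - (dim H + 2 j) q - w D q\<close> for \<open>q\<close> homogeneous of
  degree \<open>j\<close> (\<open>dirac_vector_mult\<close>), which combines the anticommutation of vectors with Euler's
  identity.

  For a unit vector \<open>a\<close> the map \<open>w \<mapsto> a w a\<close> is a reflection, so it carries an orthonormal basis of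
  \<open>a \<real>\<^sup>n a\<close> to one of \<open>\<real>\<^sup>n\<close>. As \<open>b a = - a (a b a)\<close>, the Dirac operators of the two spaces are
  intertwined by \<open>f \<mapsto> a f(a w a)\<close> (\<open>dirac_conj\<close>), because the Dirac operator does not depend on
  the basis. With \<open>x\<^sub>s\<close> fixed, \<open>J(C\<^sup>-\<^sup>1, x\<^sub>s)\<close> is a real multiple of \<open>a\<close>.

  Finally \<open>C(x) - e\<^bsub>n+1\<^esub>\<close> is a nonzero real multiple of \<open>x + e\<^bsub>n+1\<^esub>\<close> (\<open>cayley_diff_e_last\<close>).
  Hence \<open>a\<close> is indeed a unit vector, and \<open>C\<^sup>-\<^sup>1(C(x)) = x\<close>, so that the hypothesis on \<open>g\<close> applies
  at \<open>C\<^sup>-\<^sup>1(x\<^sub>s)\<close>.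
\<close>

section \<open>Directional derivatives of polynomials\<close>

lemma dir_deriv_eq_derivative:
  assumes "(f has_derivative f') (at x)"
  shows "dir_deriv v f x = f' v"
proof -
  have "((\<lambda>t. x + t *\<^sub>R v) has_derivative (\<lambda>t. t *\<^sub>R v)) (at 0)"
    by (auto intro!: derivative_eq_intros)
  moreover have "(f has_derivative f') (at (x + 0 *\<^sub>R v))"
    using assms by simp
  ultimately have "((\<lambda>t. f (x + t *\<^sub>R v)) has_derivative (\<lambda>t. f' (t *\<^sub>R v))) (at 0)"
    by (rule has_derivative_compose)
  moreover have "f' (t *\<^sub>R v) = t *\<^sub>R f' v" for t
    using assms by (simp add: has_derivative_linear linear_scale)
  ultimately show ?thesis
    unfolding dir_deriv_def
    by (intro vector_derivative_at) (simp add: has_vector_derivative_def)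
qed

lemma dir_deriv_bounded_linear:
  assumes "bounded_linear h" and "f differentiable at x"
  shows "dir_deriv v (\<lambda>y. h (f y)) x = h (dir_deriv v f x)"
proof -
  obtain f' where "(f has_derivative f') (at x)"
    using assms(2) by (auto simp: differentiable_def)
  then show ?thesis
    using bounded_linear.has_derivative[OF assms(1), of f f' "at x"]
    by (simp add: dir_deriv_eq_derivative)
qed

lemma dir_deriv_add:
  assumes "f differentiable at x" and "g differentiable at x"
  shows "dir_deriv v (\<lambda>y. f y + g y) x = dir_deriv v f x + dir_deriv v g x"
proof -
  obtain f' g' where "(f has_derivative f') (at x)" "(g has_derivative g') (at x)"
    using assms by (auto simp: differentiable_def)
  then show ?thesis
    using has_derivative_add by (fastforce simp: dir_deriv_eq_derivative)
qed

lemma dir_deriv_bilinear: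
  assumes "bounded_bilinear h" and "f differentiable at x" and "g differentiable at x"
  shows "dir_deriv v (\<lambda>y. h (f y) (g y)) x = h (f x) (dir_deriv v g x) + h (dir_deriv v f x) (g x)"
proof -
  obtain f' g' where "(f has_derivative f') (at x)" "(g has_derivative g') (at x)"
    using assms by (auto simp: differentiable_def)
  then show ?thesis
    using bounded_bilinear.FDERIV[OF assms(1)] by (fastforce simp: dir_deriv_eq_derivative)
qed

lemma linear_dir_deriv:
  assumes "f differentiable at x"
  shows "linear (\<lambda>v. dir_deriv v f x)"
proof -
  obtain f' where "(f has_derivative f') (at x)"
    using assms by (auto simp: differentiable_def)
  then show ?thesis
    by (simp add: dir_deriv_eq_derivative has_derivative_linear)
qed

text \<open>
  On a subspace the derivatives along the subspace see the values there only, which is what allows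
  a polynomial on \<open>H\<close> to be replaced by any polynomial on the whole space that extends it.
\<close>

lemma dir_deriv_cong_subspace:
  assumes "subspace H" and "v \<in> H" and "x \<in> H" and "\<And>y. y \<in> H \<Longrightarrow> f y = g y"
  shows "dir_deriv v f x = dir_deriv v g x"
proof -
  have "x + t *\<^sub>R v \<in> H" for t
    using assms by (simp add: subspace_add subspace_scale)
  then show ?thesis
    by (simp add: dir_deriv_def assms(4))
qed

text \<open>Euler's identity: on the line through \<open>0\<close> and \<open>x\<close> the function \<open>f\<close> is a monomial.\<close>

lemma dir_deriv_homogeneous:
  assumes "\<And>t::real. f (t *\<^sub>R x) = t ^ k *\<^sub>R f x"
  shows "dir_deriv x f x = real k *\<^sub>R f x"
proof -
  have "f (x + t *\<^sub>R x) = (1 + t) ^ k *\<^sub>R f x" for t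
    using assms[of "1 + t"] by (simp add: scaleR_add_left)
  moreover have "((\<lambda>t::real. (1 + t) ^ k *\<^sub>R f x) has_vector_derivative real k *\<^sub>R f x) (at 0)"
    by (auto simp: has_vector_derivative_def intro!: derivative_eq_intros)
  ultimately show ?thesis
    by (simp only: dir_deriv_def vector_derivative_at)
qed

lemma real_polynomial_function_differentiable:
  "real_polynomial_function f \<Longrightarrow> f differentiable at x"
proof (induction f rule: real_polynomial_function.induct)
  case (linear f)
  then show ?case
    by (simp add: bounded_linear_imp_differentiable)
qed auto

lemma real_polynomial_function_dir_deriv:
  "real_polynomial_function f \<Longrightarrow> real_polynomial_function (dir_deriv v f)"
proof (induction f rule: real_polynomial_function.induct)
  case (linear f)
  then have "dir_deriv v f = (\<lambda>x. f v)"
    by (auto intro!: dir_deriv_eq_derivative bounded_linear_imp_has_derivative)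
  then show ?case
    by auto
next
  case (const c)
  have "dir_deriv v (\<lambda>x. c) = (\<lambda>x. 0)"
    by (auto intro!: dir_deriv_eq_derivative)
  then show ?case
    by auto
next
  case (add f g)
  then have "dir_deriv v (\<lambda>x. f x + g x) = (\<lambda>x. dir_deriv v f x + dir_deriv v g x)"
    by (auto simp: dir_deriv_add real_polynomial_function_differentiable)
  with add show ?case
    by auto
next
  case (mult f g)
  then have "dir_deriv v (\<lambda>x. f x * g x) = (\<lambda>x. f x * dir_deriv v g x + dir_deriv v f x * g x)"
    by (auto simp: dir_deriv_bilinear[OF bounded_bilinear_mult] real_polynomial_function_differentiable)
  with mult show ?case
    by auto
qed

text \<open>
  Polynomials are built from linear functions by sums and products, so the symmetry of the second
  derivatives follows from the product rule alone.
\<close>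

lemma real_polynomial_function_dir_deriv_commute:
  "real_polynomial_function f \<Longrightarrow> dir_deriv u (dir_deriv v f) x = dir_deriv v (dir_deriv u f) x"
proof (induction f arbitrary: x rule: real_polynomial_function.induct)
  case (linear f)
  then have "dir_deriv v f = (\<lambda>x. f v)" for v
    by (auto intro!: dir_deriv_eq_derivative bounded_linear_imp_has_derivative)
  moreover have "dir_deriv v (\<lambda>x. c) = (\<lambda>x. 0)" for v :: 'a and c :: real
    by (auto intro!: dir_deriv_eq_derivative)
  ultimately show ?case
    by simp
next
  case (const c)
  have "dir_deriv v (\<lambda>x. c) = (\<lambda>x. 0)" for v :: 'a and c :: real
    by (auto intro!: dir_deriv_eq_derivative)
  then show ?case
    by simp
next
  case (add f g)
  then have "dir_deriv v (\<lambda>x. f x + g x) = (\<lambda>x. dir_deriv v f x + dir_deriv v g x)" for v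
    by (auto simp: dir_deriv_add real_polynomial_function_differentiable)
  with add show ?case
    by (simp add: dir_deriv_add real_polynomial_function_differentiable
        real_polynomial_function_dir_deriv)
next
  case (mult f g)
  have *: "dir_deriv v (\<lambda>x. f x * g x) = (\<lambda>x. f x * dir_deriv v g x + dir_deriv v f x * g x)" for v
    using mult.hyps
    by (auto simp: dir_deriv_bilinear[OF bounded_bilinear_mult] real_polynomial_function_differentiable)
  have **: "dir_deriv u (dir_deriv v (\<lambda>x. f x * g x)) x =
      (f x * dir_deriv u (dir_deriv v g) x + dir_deriv u f x * dir_deriv v g x) +
      (dir_deriv v f x * dir_deriv u g x + dir_deriv u (dir_deriv v f) x * g x)" for u v
    unfolding * using mult.hyps
    by (subst dir_deriv_add)
      (auto simp: dir_deriv_bilinear[OF bounded_bilinear_mult] real_polynomial_function_differentiable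
        real_polynomial_function_dir_deriv)
  show ?case
    unfolding ** by (simp add: mult.IH)
qed

text \<open>
  The facts for vector-valued polynomials follow from those for scalar ones, since a bounded linear
  functional commutes with directional derivatives.
\<close>

lemma polynomial_function_differentiable:
  fixes f :: "'a::real_normed_vector \<Rightarrow> 'b::euclidean_space"
  assumes "polynomial_function f"
  shows "f differentiable at x"
proof -
  have "(\<lambda>y. f y \<bullet> b) differentiable at x" for b
  proof -
    have "real_polynomial_function ((\<lambda>y. y \<bullet> b) \<circ> f)"
      using assms bounded_linear_inner_left unfolding polynomial_function_def by blast
    then show ?thesis
      using real_polynomial_function_differentiable by (force simp: o_def)
  qed
  then show ?thesis
    using differentiable_componentwise_within by blast
qed

lemma polynomial_function_dir_deriv:
  fixes f :: "'a::real_normed_vector \<Rightarrow> 'b::euclidean_space"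
  assumes "polynomial_function f"
  shows "polynomial_function (dir_deriv v f)"
  unfolding polynomial_function_def
proof (intro allI impI)
  fix h :: "'b \<Rightarrow> real" assume h: "bounded_linear h"
  have "h \<circ> dir_deriv v f = dir_deriv v (h \<circ> f)"
    using dir_deriv_bounded_linear[OF h polynomial_function_differentiable[OF assms]]
    by (auto simp: o_def)
  moreover have "real_polynomial_function (h \<circ> f)"
    using assms h by (simp add: polynomial_function_def)
  ultimately show "real_polynomial_function (h \<circ> dir_deriv v f)"
    by (simp add: real_polynomial_function_dir_deriv)
qed

lemma polynomial_function_dir_deriv_commute:
  fixes f :: "'a::real_normed_vector \<Rightarrow> 'b::euclidean_space"
  assumes "polynomial_function f"
  shows "dir_deriv u (dir_deriv v f) x = dir_deriv v (dir_deriv u f) x"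
proof (rule euclidean_eqI)
  fix b :: 'b
  have "dir_deriv v (\<lambda>y. h y \<bullet> b) = (\<lambda>y. dir_deriv v h y \<bullet> b)"
    if "polynomial_function h" for v and h :: "'a \<Rightarrow> 'b"
    using dir_deriv_bounded_linear[OF bounded_linear_inner_left polynomial_function_differentiable[OF that]]
    by auto
  then have *: "dir_deriv u (dir_deriv v f) x \<bullet> b = dir_deriv u (dir_deriv v (\<lambda>y. f y \<bullet> b)) x" for u v
    using assms by (simp add: polynomial_function_dir_deriv)
  have "real_polynomial_function ((\<lambda>y. y \<bullet> b) \<circ> f)"
    using assms bounded_linear_inner_left unfolding polynomial_function_def by blast
  then show "dir_deriv u (dir_deriv v f) x \<bullet> b = dir_deriv v (dir_deriv u f) x \<bullet> b"
    unfolding * by (simp add: real_polynomial_function_dir_deriv_commute o_def)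
qed


section \<open>Vectors in the Clifford algebra\<close>

lemma bounded_linear_clifford_mult: "bounded_linear (\<lambda>x. c * x * d :: 'i::finite clifford)"
  unfolding linear_conv_bounded_linear[symmetric]
  by (rule linearI) (simp_all add: algebra_simps)

lemma bounded_bilinear_clifford:
  "bounded_bilinear ((*) :: 'i::finite clifford \<Rightarrow> 'i clifford \<Rightarrow> 'i clifford)"
  unfolding bilinear_conv_bounded_bilinear[symmetric]
  by (auto simp: bilinear_def algebra_simps intro!: linearI)

lemma vector_anticommute:
  fixes v w :: "'i::finite clifford"
  assumes "v \<in> span (range gen)" and "w \<in> span (range gen)"
  shows "v * w + w * v = (- 2 * (v \<bullet> w)) *\<^sub>R 1"
proof (rule bilinear_eq[where f = "\<lambda>v w. v * w + w * v" and g = "\<lambda>v w. (- 2 * (v \<bullet> w)) *\<^sub>R 1"])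
  show "bilinear (\<lambda>v w :: 'i clifford. v * w + w * v)"
    by (auto simp: bilinear_def algebra_simps intro!: linearI)
  show "bilinear (\<lambda>v w :: 'i clifford. (- 2 * (v \<bullet> w)) *\<^sub>R (1 :: 'i clifford))"
    by (auto simp: bilinear_def inner_add algebra_simps intro!: linearI)
  fix x y :: "'i clifford" assume "x \<in> range gen" "y \<in> range gen"
  then obtain i j where [simp]: "x = gen i" "y = gen j"
    by auto
  have "gen i \<bullet> gen j = (if i = j then 1 else 0 :: real)"
    by (auto simp: gen_def inner_blade coeff_blade)
  moreover have "(- 2 :: real) *\<^sub>R (1 :: 'i clifford) = - 2"
    by (metis of_real_def of_real_minus of_real_numeral)
  ultimately show "x * y + y * x = (- 2 * (x \<bullet> y)) *\<^sub>R 1"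
    by (simp add: gen_anticommute)
qed (use assms in auto)

lemma vector_square:
  fixes v :: "'i::finite clifford"
  assumes "v \<in> span (range gen)"
  shows "v * v = - ((norm v)\<^sup>2 *\<^sub>R 1)"
proof -
  have "2 *\<^sub>R (v * v) = 2 *\<^sub>R (- ((norm v)\<^sup>2 *\<^sub>R 1))"
    using vector_anticommute[OF assms assms]
    by (simp add: scaleR_2 power2_norm_eq_inner scaleR_add_left[symmetric])
  then show ?thesis
    by (metis real_vector.scale_cancel_left zero_neq_numeral)
qed

lemma cl_inverse_eqI:
  assumes "x * y = 1" and "y * x = 1"
  shows "cl_inverse x = y"
  unfolding cl_inverse_def
proof (rule the_equality)
  fix z assume "x * z = 1 \<and> z * x = 1"
  then show "z = y"
    by (metis assms mult.assoc mult_1_left mult_1_right)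
qed (use assms in simp)

lemma cl_inverse_vector:
  fixes v :: "'i::finite clifford"
  assumes "v \<in> span (range gen)" and "v \<noteq> 0"
  shows "cl_inverse v = - (v /\<^sub>R (norm v)\<^sup>2)"
  by (rule cl_inverse_eqI) (use assms in \<open>auto simp: vector_square\<close>)

text \<open>
  Anticommuting \<open>a\<close> past \<open>w\<close> shows that \<open>w \<mapsto> a w a\<close> is the reflection in the hyperplane orthogonal
  to \<open>a\<close>. Hence it maps vectors to vectors and is isometric on them.
\<close>

lemma conj_unit_vector:
  fixes a w :: "'i::finite clifford"
  assumes "a \<in> span (range gen)" and "norm a = 1" and "w \<in> span (range gen)"
  shows "a * w * a = w - (2 * (a \<bullet> w)) *\<^sub>R a"
proof -
  have "a * w = - (w * a) - (2 * (a \<bullet> w)) *\<^sub>R 1"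
    using vector_anticommute[OF assms(1,3)] by (simp add: algebra_simps eq_neg_iff_add_eq_0)
  then have "a * w * a = (- (w * a) - (2 * (a \<bullet> w)) *\<^sub>R 1) * a"
    by simp
  also have "\<dots> = - (w * (a * a)) - (2 * (a \<bullet> w)) *\<^sub>R a"
    by (simp add: algebra_simps)
  finally show ?thesis
    using assms by (simp add: vector_square)
qed

lemma conj_unit_vector_inner:
  fixes a v w :: "'i::finite clifford"
  assumes "a \<in> span (range gen)" and "norm a = 1"
    and "v \<in> span (range gen)" and "w \<in> span (range gen)"
  shows "(a * v * a) \<bullet> (a * w * a) = v \<bullet> w"
proof -
  have "a \<bullet> a = 1"
    using assms(2) by (simp add: norm_eq_1)
  then show ?thesis
    unfolding conj_unit_vector[OF assms(1,2,3)] conj_unit_vector[OF assms(1,2,4)]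
    by (simp add: inner_diff inner_commute algebra_simps)
qed

lemma conj_unit_vector_involution:
  fixes a :: "'i::finite clifford"
  assumes "a \<in> span (range gen)" and "norm a = 1"
  shows "a * (a * w * a) * a = w"
proof -
  have "a * (a * w * a) * a = (a * a) * w * (a * a)"
    by (simp only: mult.assoc)
  then show ?thesis
    using assms by (simp add: vector_square)
qed


section \<open>Dirac operator and Laplacian on a subspace\<close>

lemma finite_orthonormal_basis:
  fixes B :: "'a::euclidean_space set"
  assumes "orthonormal_basis H B"
  shows "finite B"
proof -
  have "0 \<notin> B"
    using assms by (force simp: orthonormal_basis_def)
  then show ?thesis
    using assms pairwise_orthogonal_independent finiteI_independent
    by (auto simp: orthonormal_basis_def)
qed

lemma orthonormal_basis_sum:
  fixes B :: "'a::euclidean_space set"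
  assumes "orthonormal_basis H B" and "x \<in> H"
  shows "(\<Sum>b\<in>B. (x \<bullet> b) *\<^sub>R b) = x"
  using assms finite_orthonormal_basis[OF assms(1)] orthonormal_basis_expand[of B x]
  by (auto simp: orthonormal_basis_def)

lemma linear_orthonormal_basis_sum:
  fixes B :: "'a::euclidean_space set"
  assumes "orthonormal_basis H B" and "x \<in> H" and "linear L"
  shows "(\<Sum>b\<in>B. (x \<bullet> b) *\<^sub>R L b) = L x"
proof -
  have "L x = L (\<Sum>b\<in>B. (x \<bullet> b) *\<^sub>R b)"
    using assms by (simp add: orthonormal_basis_sum)
  then show ?thesis
    using assms(3) by (simp add: linear_sum linear_scale)
qed

text \<open>
  Both sides are the contraction of the bilinear map \<open>(v, w) \<mapsto> v L(w)\<close> with the inner product of \<open>H\<close>.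
\<close>

lemma orthonormal_basis_contraction:
  fixes B C :: "'i::finite clifford set"
  assumes B: "orthonormal_basis H B" and C: "orthonormal_basis H C" and L: "linear L"
  shows "(\<Sum>b\<in>B. b * L b) = (\<Sum>c\<in>C. c * L c)"
proof -
  have "(\<Sum>b\<in>B. b * L b) = (\<Sum>b\<in>B. \<Sum>c\<in>C. (b \<bullet> c) *\<^sub>R (b * L c))"
  proof (rule sum.cong[OF refl])
    fix b assume "b \<in> B"
    then have "b \<in> H"
      using B by (auto simp: orthonormal_basis_def)
    from linear_orthonormal_basis_sum[OF C this L, symmetric]
    show "b * L b = (\<Sum>c\<in>C. (b \<bullet> c) *\<^sub>R (b * L c))"
      by (simp add: sum_distrib_left)
  qed
  also have "\<dots> = (\<Sum>c\<in>C. \<Sum>b\<in>B. ((c \<bullet> b) *\<^sub>R b) * L c)"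
    by (subst sum.swap) (simp add: inner_commute)
  also have "\<dots> = (\<Sum>c\<in>C. c * L c)"
  proof (rule sum.cong[OF refl])
    fix c assume "c \<in> C"
    then have "c \<in> H"
      using C by (auto simp: orthonormal_basis_def)
    then show "(\<Sum>b\<in>B. ((c \<bullet> b) *\<^sub>R b) * L c) = c * L c"
      by (simp only: sum_distrib_right[symmetric] orthonormal_basis_sum[OF B])
  qed
  finally show ?thesis .
qed

lemma dirac_eq_orthonormal_basis:
  assumes "orthonormal_basis H B" and "f differentiable at x"
  shows "dirac H f x = (\<Sum>b\<in>B. b * dir_deriv b f x)"
proof -
  have "subspace H"
    using assms(1) by (auto simp: orthonormal_basis_def)
  then show ?thesis
    unfolding dirac_def
    by (intro orthonormal_basis_contraction[OF orthonormal_basis_some_basis assms(1)]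
        linear_dir_deriv assms(2))
qed

lemma some_basis_subset: "subspace H \<Longrightarrow> some_basis H \<subseteq> H"
  for H :: "'a::euclidean_space set"
  using orthonormal_basis_some_basis by (auto simp: orthonormal_basis_def)

lemma dirac_cong_subspace:
  assumes "subspace H" and "x \<in> H" and "\<And>y. y \<in> H \<Longrightarrow> f y = g y"
  shows "dirac H f x = dirac H g x"
  unfolding dirac_def
  using assms(2,3) some_basis_subset[OF assms(1)]
  by (intro sum.cong refl arg_cong2[where f = "(*)"] dir_deriv_cong_subspace[OF assms(1)]) auto

lemma laplacian_cong_subspace:
  assumes "subspace H" and "x \<in> H" and "\<And>y. y \<in> H \<Longrightarrow> f y = g y"
  shows "laplacian H f x = laplacian H g x"
  unfolding laplacian_def
  using assms(2,3) some_basis_subset[OF assms(1)]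
  by (intro sum.cong refl dir_deriv_cong_subspace[OF assms(1)]) auto

lemma dirac_add:
  assumes "f differentiable at x" and "g differentiable at x"
  shows "dirac H (\<lambda>y. f y + g y) x = dirac H f x + dirac H g x"
  by (simp add: dirac_def dir_deriv_add assms algebra_simps sum.distrib)

text \<open>
  The Dirac operator squares to minus the Laplacian: in the double sum the terms \<open>b c \<partial>\<^sub>b \<partial>\<^sub>c\<close> and
  \<open>c b \<partial>\<^sub>c \<partial>\<^sub>b\<close> of distinct directions cancel, because the derivatives commute and the vectors
  anticommute.
\<close>

lemma dirac_dirac:
  fixes p :: "'i::finite clifford \<Rightarrow> 'i clifford"
  assumes "subspace H" and H: "H \<subseteq> span (range gen)" and p: "polynomial_function p"
  shows "dirac H (dirac H p) x = - laplacian H p x"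
proof -
  define B where "B = some_basis H"
  have B: "orthonormal_basis H B"
    unfolding B_def using assms(1) by (rule orthonormal_basis_some_basis)
  have fin: "finite B"
    using B by (rule finite_orthonormal_basis)
  have vec: "b \<in> span (range gen)" if "b \<in> B" for b
    using B H that by (auto simp: orthonormal_basis_def)
  define d where "d b c = dir_deriv b (dir_deriv c p) x" for b c
  have "dirac H (dirac H p) x = (\<Sum>b\<in>B. b * (\<Sum>c\<in>B. c * d b c))"
  proof -
    have "dir_deriv b (dirac H p) x = (\<Sum>c\<in>B. c * d b c)" for b
    proof -
      have "(dirac H p has_derivative
          (\<lambda>v. \<Sum>c\<in>B. c * frechet_derivative (dir_deriv c p) (at x) v)) (at x)"
      proof -
        \<comment> \<open>the factor \<open>1\<close> gives the two-sided form \<open>c * x * d\<close> of the bounded linear map\<close>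
        have "((\<lambda>y. \<Sum>c\<in>B. c * dir_deriv c p y * 1) has_derivative
            (\<lambda>v. \<Sum>c\<in>B. c * frechet_derivative (dir_deriv c p) (at x) v * 1)) (at x)"
          using polynomial_function_differentiable[OF polynomial_function_dir_deriv[OF p]]
          by (intro has_derivative_sum bounded_linear.has_derivative[OF bounded_linear_clifford_mult])
            (simp add: frechet_derivative_works)
        moreover have "dirac H p = (\<lambda>y. \<Sum>c\<in>B. c * dir_deriv c p y * 1)"
          by (auto simp: dirac_def B_def)
        ultimately show ?thesis
          by simp
      qed
      moreover have "frechet_derivative (dir_deriv c p) (at x) b = d b c" for c
        unfolding d_def
        using polynomial_function_differentiable[OF polynomial_function_dir_deriv[OF p]]
        by (intro dir_deriv_eq_derivative[symmetric]) (simp add: frechet_derivative_works)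
      ultimately show ?thesis
        by (simp add: dir_deriv_eq_derivative)
    qed
    then show ?thesis
      by (simp add: dirac_def[of H "dirac H p"] B_def)
  qed
  then have eq: "dirac H (dirac H p) x = (\<Sum>b\<in>B. \<Sum>c\<in>B. b * c * d b c)"
    by (simp add: sum_distrib_left mult.assoc)
  \<comment> \<open>exchange the names of the two directions; the mixed derivative is symmetric\<close>
  also have "\<dots> = (\<Sum>b\<in>B. \<Sum>c\<in>B. c * b * d b c)"
    by (subst sum.swap) (simp add: d_def polynomial_function_dir_deriv_commute[OF p])
  finally have "2 *\<^sub>R dirac H (dirac H p) x = (\<Sum>b\<in>B. \<Sum>c\<in>B. (b * c + c * b) * d b c)"
    by (simp add: scaleR_2 eq distrib_right sum.distrib)
  also have "\<dots> = (\<Sum>b\<in>B. \<Sum>c\<in>B. if c = b then - 2 *\<^sub>R d b b else 0)"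
  proof (intro sum.cong refl)
    fix b c assume "b \<in> B" "c \<in> B"
    then have "b \<bullet> c = (if c = b then 1 else 0)"
      using B by (auto simp: orthonormal_basis_def pairwise_def orthogonal_def norm_eq_1)
    then show "(b * c + c * b) * d b c = (if c = b then - 2 *\<^sub>R d b b else 0)"
      using \<open>b \<in> B\<close> \<open>c \<in> B\<close> by (simp add: vector_anticommute vec)
  qed
  also have "\<dots> = 2 *\<^sub>R - laplacian H p x"
    using fin by (simp add: laplacian_def B_def[symmetric] d_def scaleR_sum_right sum_negf)
  finally show ?thesis
    by (metis real_vector.scale_cancel_left zero_neq_numeral)
qed

lemma homogeneous_polysE:
  assumes "f \<in> homogeneous_polys H k"
  obtains p where "polynomial_function p" and "\<And>x. x \<in> H \<Longrightarrow> f x = p x"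
  using assms by (auto simp: homogeneous_polys_def)

lemma monogenic_polys_subset_harmonic_polys:
  fixes H :: "'i::finite clifford set"
  assumes H: "subspace H" and vec: "H \<subseteq> span (range gen)"
  shows "monogenic_polys H k \<subseteq> harmonic_polys H k"
proof
  fix f assume f: "f \<in> monogenic_polys H k"
  then obtain p where p: "polynomial_function p" and fp: "\<And>x. x \<in> H \<Longrightarrow> f x = p x"
    by (auto simp: monogenic_polys_def elim: homogeneous_polysE)
  have dp: "dirac H p y = 0" if "y \<in> H" for y
    using f that dirac_cong_subspace[OF H that, of f p] fp by (simp add: monogenic_polys_def)
  have "laplacian H f x = 0" if x: "x \<in> H" for x
  proof -
    have "dirac H (dirac H p) x = dirac H (\<lambda>y. 0) x"
      by (rule dirac_cong_subspace[OF H x dp])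
    also have "\<dots> = 0"
      by (simp add: dirac_def dir_deriv_def)
    finally show ?thesis
      using laplacian_cong_subspace[OF H x fp] by (simp add: dirac_dirac[OF H vec p])
  qed
  with f show "f \<in> harmonic_polys H k"
    by (simp add: monogenic_polys_def harmonic_polys_def)
qed

text \<open>
  Moving \<open>b\<close> past the variable in \<open>b \<partial>\<^sub>b (w q)\<close> leaves, besides \<open>- w b \<partial>\<^sub>b q\<close>, the constant
  \<open>b b = -1\<close> once for each direction and the terms \<open>-2 (w \<bullet> b) \<partial>\<^sub>b q\<close>, which add up to the Euler
  operator and hence to the degree.
\<close>

lemma dirac_vector_mult:
  fixes q :: "'i::finite clifford \<Rightarrow> 'i clifford"
  assumes H: "subspace H" and vec: "H \<subseteq> span (range gen)" and x: "x \<in> H"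
    and q: "q differentiable at x" and hom: "\<And>t::real. q (t *\<^sub>R x) = t ^ k *\<^sub>R q x"
  shows "dirac H (\<lambda>w. w * q w) x =
    - (real (card (some_basis H) + 2 * k) *\<^sub>R q x) - x * dirac H q x"
proof -
  define B where "B = some_basis H"
  have B: "orthonormal_basis H B"
    unfolding B_def using H by (rule orthonormal_basis_some_basis)
  have "dirac H (\<lambda>w. w * q w) x =
      (\<Sum>b\<in>B. - q x - x * (b * dir_deriv b q x) - 2 *\<^sub>R ((x \<bullet> b) *\<^sub>R dir_deriv b q x))"
    unfolding dirac_def B_def[symmetric]
  proof (rule sum.cong[OF refl])
    fix b assume "b \<in> B"
    then have b: "b \<in> span (range gen)" "norm b = 1"
      using B vec by (auto simp: orthonormal_basis_def)
    have "dir_deriv b (\<lambda>w. w) x = b"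
      by (rule dir_deriv_eq_derivative) (rule has_derivative_ident)
    then have "b * dir_deriv b (\<lambda>w. w * q w) x = (b * x) * dir_deriv b q x + (b * b) * q x"
      by (simp add: dir_deriv_bilinear[OF bounded_bilinear_clifford] q algebra_simps)
    moreover have "b * x = - (x * b) - (2 * (x \<bullet> b)) *\<^sub>R 1"
      using vector_anticommute[OF b(1), of x] x vec
      by (auto simp: algebra_simps inner_commute eq_neg_iff_add_eq_0)
    ultimately show "b * dir_deriv b (\<lambda>w. w * q w) x =
        - q x - x * (b * dir_deriv b q x) - 2 *\<^sub>R ((x \<bullet> b) *\<^sub>R dir_deriv b q x)"
      using b by (simp add: vector_square algebra_simps)
  qed
  also have "\<dots> = - (real (card B) *\<^sub>R q x) - x * dirac H q x -
      2 *\<^sub>R (\<Sum>b\<in>B. (x \<bullet> b) *\<^sub>R dir_deriv b q x)"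
    by (simp add: dirac_def B_def[symmetric] sum_subtractf sum_negf sum_distrib_left scaleR_sum_right
        sum_constant_scaleR del: sum_constant)
  also have "(\<Sum>b\<in>B. (x \<bullet> b) *\<^sub>R dir_deriv b q x) = real k *\<^sub>R q x"
    using linear_orthonormal_basis_sum[OF B x linear_dir_deriv[OF q]] dir_deriv_homogeneous[OF hom]
    by simp
  finally show ?thesis
    by (simp add: B_def algebra_simps)
qed


section \<open>The Almansi-Fischer projection fixes monogenic polynomials\<close>

text \<open>
  If \<open>f\<close> and \<open>p\<close> are monogenic and \<open>f = p + w q\<close> with \<open>q\<close> monogenic of degree \<open>j\<close>, applying the
  Dirac operator gives \<open>(dim H + 2 j) q = 0\<close>. So \<open>f = f + w 0\<close> is the only decomposition. Where
  the factor vanishes, \<open>H\<close> is the zero space and \<open>w q\<close> vanishes for that reason.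
\<close>

lemma fischer_decomposition_monogenic:
  fixes H :: "'i::finite clifford set"
  assumes H: "subspace H" and vec: "H \<subseteq> span (range gen)"
    and f: "f \<in> monogenic_polys H k" and p: "p \<in> monogenic_polys H k"
    and q: "q \<in> monogenic_polys_pred H k" and eq: "f = (\<lambda>w\<in>H. p w + w * q w)"
  shows "p = f"
proof -
  have "x * q x = 0" if x: "x \<in> H" for x
  proof (cases k)
    case 0
    then show ?thesis
      using q x by (simp add: monogenic_polys_pred_def)
  next
    case (Suc j)
    then have q: "q \<in> monogenic_polys H j"
      using q by (simp add: monogenic_polys_pred_def)
    obtain P where P: "polynomial_function P" "\<And>y. y \<in> H \<Longrightarrow> p y = P y"
      using p by (auto simp: monogenic_polys_def elim: homogeneous_polysE)
    obtain Q where Q: "polynomial_function Q" "\<And>y. y \<in> H \<Longrightarrow> q y = Q y"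
      using q by (auto simp: monogenic_polys_def elim: homogeneous_polysE)
    have hom: "Q (t *\<^sub>R x) = t ^ j *\<^sub>R Q x" for t :: real
      using q x H Q(2)
      by (auto simp: monogenic_polys_def homogeneous_polys_def subspace_scale)
    have diff: "P differentiable at x" "Q differentiable at x"
      using P(1) Q(1) by (simp_all add: polynomial_function_differentiable)
    have "(\<lambda>w. w * Q w) differentiable at x"
      using diff(2) bounded_bilinear.FDERIV[OF bounded_bilinear_clifford has_derivative_ident, of Q _ x]
      unfolding differentiable_def by blast
    then have "dirac H (\<lambda>w. P w + w * Q w) x = dirac H P x + dirac H (\<lambda>w. w * Q w) x"
      by (rule dirac_add[OF diff(1)])
    moreover have "dirac H (\<lambda>w. P w + w * Q w) x = dirac H f x"
      by (rule dirac_cong_subspace[OF H x]) (simp add: eq P(2) Q(2))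
    moreover have "dirac H P x = dirac H p x" "dirac H Q x = dirac H q x"
      by (rule dirac_cong_subspace[OF H x], simp add: P(2) Q(2))+
    ultimately have "real (card (some_basis H) + 2 * j) *\<^sub>R q x = 0"
      using f p q x dirac_vector_mult[OF H vec x diff(2) hom] Q(2)
      by (simp add: monogenic_polys_def)
    \<comment> \<open>for \<open>j = 0\<close> the factor is the dimension of \<open>H\<close>, which may be zero\<close>
    moreover have "x = 0" if "card (some_basis H) + 2 * j = 0"
    proof -
      have "some_basis H = {}"
        using that finite_orthonormal_basis[OF orthonormal_basis_some_basis[OF H]] by simp
      then show ?thesis
        using x orthonormal_basis_some_basis[OF H] by (auto simp: orthonormal_basis_def)
    qed
    ultimately show ?thesis
      by (metis mult_zero_left mult_zero_right of_nat_eq_0_iff scaleR_eq_0_iff)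
  qed
  moreover have "p \<in> extensional H"
    using p by (simp add: monogenic_polys_def homogeneous_polys_def)
  ultimately show ?thesis
    unfolding eq by (intro extensionalityI[of _ H]) auto
qed

lemma zero_monogenic_polys_pred: "(\<lambda>w\<in>H. 0) \<in> monogenic_polys_pred H k"
  if "subspace H" for H :: "'i::finite clifford set"
proof (cases k)
  case (Suc j)
  have "dirac H (\<lambda>w\<in>H. 0) x = dirac H (\<lambda>w. 0) x" if "x \<in> H" for x
    by (rule dirac_cong_subspace[OF \<open>subspace H\<close> that]) simp
  then have "dirac H (\<lambda>w\<in>H. 0) x = 0" if "x \<in> H" for x
    using that by (simp add: dirac_def dir_deriv_def)
  moreover have "\<exists>p. polynomial_function p \<and> (\<forall>x\<in>H. (0 :: 'i clifford) = p x)"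
    by (intro exI[of _ "\<lambda>x. 0"]) simp
  ultimately show ?thesis
    using Suc that
    by (auto simp: monogenic_polys_pred_def monogenic_polys_def homogeneous_polys_def subspace_scale)
qed (simp add: monogenic_polys_pred_def)

lemma fischer_proj_monogenic:
  fixes H :: "'i::finite clifford set"
  assumes H: "subspace H" and vec: "H \<subseteq> span (range gen)" and f: "f \<in> monogenic_polys H k"
  shows "fischer_proj H k f = f"
proof -
  have "f \<in> extensional H"
    using f by (simp add: monogenic_polys_def homogeneous_polys_def)
  then have "f = (\<lambda>w\<in>H. f w + w * (\<lambda>w\<in>H. 0) w)"
    by (intro extensionalityI[of _ H]) auto
  then have "\<exists>q\<in>monogenic_polys_pred H k. f = (\<lambda>w\<in>H. f w + w * q w)"
    using zero_monogenic_polys_pred[OF H] by blast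
  then have "(THE p. p \<in> monogenic_polys H k \<and>
      (\<exists>q\<in>monogenic_polys_pred H k. f = (\<lambda>w\<in>H. p w + w * q w))) = f"
    using f fischer_decomposition_monogenic[OF H vec f] by (intro the_equality) blast+
  then show ?thesis
    using f monogenic_polys_subset_harmonic_polys[OF H vec] by (auto simp: fischer_proj_def)
qed


section \<open>Covariance of the Dirac operator under reflections\<close>

lemma linear_conj: "linear (\<lambda>w. a * w * a :: 'i::finite clifford)"
  using bounded_linear_clifford_mult by (rule bounded_linear.linear)

lemma subspace_conj_vimage:
  fixes a :: "'i::finite clifford"
  assumes "subspace H"
  shows "subspace {w \<in> span (range gen). a * w * a \<in> H}"
proof -
  have "{w \<in> span (range gen). a * w * a \<in> H} = span (range gen) \<inter> (\<lambda>w. a * w * a) -` H"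
    by auto
  then show ?thesis
    using linear_subspace_vimage[OF linear_conj assms] by (simp add: subspace_inter)
qed

lemma orthonormal_basis_conj:
  fixes a :: "'i::finite clifford"
  assumes a: "a \<in> span (range gen)" "norm a = 1" and vec: "H \<subseteq> span (range gen)"
    and B: "orthonormal_basis {w \<in> span (range gen). a * w * a \<in> H} B"
  shows "orthonormal_basis H ((\<lambda>w. a * w * a) ` B)"
proof -
  let ?\<phi> = "\<lambda>w. a * w * a"
  have in_vec: "b \<in> span (range gen)" if "b \<in> B" for b
    using B that by (auto simp: orthonormal_basis_def)
  have "?\<phi> h \<in> span (range gen)" if "h \<in> H" for h
    using that vec by (auto simp: conj_unit_vector[OF a] intro!: span_diff span_scale a)
  then have "H \<subseteq> ?\<phi> ` {w \<in> span (range gen). a * w * a \<in> H}"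
    using vec conj_unit_vector_involution[OF a]
    by (intro subsetI image_eqI[where f = ?\<phi>, OF sym]) auto
  then have "?\<phi> ` span B = H"
    using B by (auto simp: orthonormal_basis_def)
  then have "span (?\<phi> ` B) = H"
    by (simp add: linear_span_image[OF linear_conj])
  moreover have "pairwise orthogonal (?\<phi> ` B)"
    using B in_vec
    by (auto simp: orthonormal_basis_def pairwise_def orthogonal_def conj_unit_vector_inner[OF a])
  moreover have "norm (?\<phi> b) = 1" if "b \<in> B" for b
    using B in_vec that
    by (auto simp: orthonormal_basis_def norm_eq_1 conj_unit_vector_inner[OF a])
  ultimately show ?thesis
    using B by (auto simp: orthonormal_basis_def)
qed

text \<open>
  Since \<open>a a = -1\<close>, moving \<open>a\<close> to the left of a direction \<open>b\<close> reflects it: \<open>b a = - a (a b a)\<close>.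
  This turns the Dirac operator of the reflected space, applied to \<open>a p (a w a)\<close>, into the one of
  \<open>H\<close> applied to \<open>p\<close>, because the directions \<open>a b a\<close> form an orthonormal basis of \<open>H\<close>.
\<close>

lemma dirac_conj:
  fixes a :: "'i::finite clifford"
  assumes a: "a \<in> span (range gen)" "norm a = 1"
    and H: "subspace H" and vec: "H \<subseteq> span (range gen)"
    and p: "p differentiable at (a * x * a)"
  shows "dirac {w \<in> span (range gen). a * w * a \<in> H} (\<lambda>w. a * p (a * w * a)) x =
    - (a * dirac H p (a * x * a))"
proof -
  define K where "K = {w \<in> span (range gen). a * w * a \<in> H}"
  define B where "B = some_basis K"
  have B: "orthonormal_basis K B"
    unfolding B_def K_def using H by (intro orthonormal_basis_some_basis subspace_conj_vimage)
  let ?\<phi> = "\<lambda>w. a * w * a"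
  have C: "orthonormal_basis H (?\<phi> ` B)"
    using B unfolding K_def by (rule orthonormal_basis_conj[OF a vec])
  obtain p' where p': "(p has_derivative p') (at (?\<phi> x))"
    using p by (auto simp: differentiable_def)
  have "((\<lambda>w. p (?\<phi> w)) has_derivative (\<lambda>v. p' (?\<phi> v))) (at x)"
    by (rule has_derivative_compose[OF bounded_linear_imp_has_derivative[OF bounded_linear_clifford_mult] p'])
  then have "((\<lambda>w. a * p (?\<phi> w) * 1) has_derivative (\<lambda>v. a * p' (?\<phi> v) * 1)) (at x)"
    by (rule bounded_linear.has_derivative[OF bounded_linear_clifford_mult])
  then have "dir_deriv b (\<lambda>w. a * p (?\<phi> w)) x = a * dir_deriv (?\<phi> b) p (?\<phi> x)" for b
    using p' by (simp add: dir_deriv_eq_derivative)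
  moreover have "b * a = - (a * ?\<phi> b)" for b
  proof -
    have "a * ?\<phi> b = (a * a) * b * a"
      by (simp only: mult.assoc)
    then show ?thesis
      using a by (simp add: vector_square)
  qed
  ultimately have "dirac K (\<lambda>w. a * p (?\<phi> w)) x =
      (\<Sum>b\<in>B. - (a * ?\<phi> b) * dir_deriv (?\<phi> b) p (?\<phi> x))"
    unfolding dirac_def B_def[symmetric] by (metis (no_types, lifting) mult.assoc)
  also have "\<dots> = - (a * (\<Sum>b\<in>B. ?\<phi> b * dir_deriv (?\<phi> b) p (?\<phi> x)))"
    by (simp add: sum_distrib_left sum_negf mult.assoc)
  also have "(\<Sum>b\<in>B. ?\<phi> b * dir_deriv (?\<phi> b) p (?\<phi> x)) =
      (\<Sum>c\<in>?\<phi> ` B. c * dir_deriv c p (?\<phi> x))"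
    using conj_unit_vector_involution[OF a]
    by (subst sum.reindex) (auto intro: inj_on_inverseI[where g = ?\<phi>])
  also have "\<dots> = dirac H p (?\<phi> x)"
    using dirac_eq_orthonormal_basis[OF C p] by simp
  finally show ?thesis
    by (simp add: K_def)
qed

lemma monogenic_polys_conj:
  fixes a :: "'i::finite clifford" and c :: real
  assumes a: "a \<in> span (range gen)" "norm a = 1"
    and H: "subspace H" and vec: "H \<subseteq> span (range gen)" and f: "f \<in> monogenic_polys H k"
  defines "K \<equiv> {w \<in> span (range gen). a * w * a \<in> H}"
  shows "(\<lambda>w\<in>K. (c *\<^sub>R a) * f (a * w * a)) \<in> monogenic_polys K k"
proof -
  let ?F = "\<lambda>w\<in>K. (c *\<^sub>R a) * f (a * w * a)"
  obtain p where p: "polynomial_function p" and fp: "\<And>x. x \<in> H \<Longrightarrow> f x = p x"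
    using f by (auto simp: monogenic_polys_def elim: homogeneous_polysE)
  have cp: "polynomial_function (\<lambda>x. c *\<^sub>R p x)"
    using p by (rule polynomial_function_cmul)
  have K: "subspace K"
    unfolding K_def by (rule subspace_conj_vimage[OF H])
  have FP: "?F w = a * (c *\<^sub>R p (a * w * a))" if "w \<in> K" for w
    using that by (simp add: K_def fp)
  have "polynomial_function ((\<lambda>x. a * x * 1) \<circ> ((\<lambda>x. c *\<^sub>R p x) \<circ> (\<lambda>w. a * w * a)))"
    using bounded_linear_clifford_mult[THEN polynomial_function_bounded_linear]
    by (intro polynomial_function_compose cp) blast+
  then have poly: "polynomial_function (\<lambda>w. a * (c *\<^sub>R p (a * w * a)))"
    by (simp add: o_def)
  have hom: "?F (t *\<^sub>R w) = t ^ k *\<^sub>R ?F w" if "w \<in> K" for w and t :: real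
  proof -
    have "t *\<^sub>R w \<in> K"
      using K that by (rule subspace_scale)
    moreover have "f (t *\<^sub>R (a * w * a)) = t ^ k *\<^sub>R f (a * w * a)"
      using f that by (simp add: K_def monogenic_polys_def homogeneous_polys_def)
    ultimately show ?thesis
      using that by simp
  qed
  have "dirac K ?F w = 0" if w: "w \<in> K" for w
  proof -
    have h: "a * w * a \<in> H"
      using w by (simp add: K_def)
    have "dirac K ?F w = dirac K (\<lambda>w. a * (c *\<^sub>R p (a * w * a))) w"
      by (rule dirac_cong_subspace[OF K w FP])
    also have "\<dots> = - (a * dirac H (\<lambda>x. c *\<^sub>R p x) (a * w * a))"
      unfolding K_def using cp
      by (intro dirac_conj[OF a H vec] polynomial_function_differentiable)
    also have "dirac H (\<lambda>x. c *\<^sub>R p x) (a * w * a) = c *\<^sub>R dirac H p (a * w * a)"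
      by (simp add: dirac_def scaleR_sum_right
          dir_deriv_bounded_linear[OF bounded_linear_scaleR_right polynomial_function_differentiable[OF p]])
    also have "dirac H p (a * w * a) = dirac H f (a * w * a)"
      by (rule dirac_cong_subspace[OF H h]) (simp add: fp)
    also have "\<dots> = 0"
      using f h by (simp add: monogenic_polys_def)
    finally show ?thesis
      by (simp only: mult_zero_right scaleR_zero_right minus_zero)
  qed
  then show ?thesis
    using hom poly FP unfolding monogenic_polys_def homogeneous_polys_def
    by blast
qed


section \<open>The Cayley transformation\<close>

lemma e_last_vector: "e_last \<in> span (range gen)"
  by (simp add: span_base)

lemma Rn_subset_vectors: "Rn \<subseteq> span (range gen)"
  unfolding Rn_def by (rule span_mono) auto

lemma subspace_Rn: "subspace Rn"
  by (simp add: Rn_def)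

lemma e_last_notin_Rn: "e_last \<notin> Rn"
proof
  assume "(e_last :: 'n::finite option clifford) \<in> Rn"
  moreover have "orthogonal e_last y" if "y \<in> range (\<lambda>i :: 'n. gen (Some i))" for y
    using that by (auto simp: orthogonal_def gen_def inner_blade coeff_blade)
  ultimately have "orthogonal (e_last :: 'n option clifford) e_last"
    unfolding Rn_def by (rule orthogonal_to_span)
  then show False
    by (simp add: orthogonal_def gen_def inner_blade coeff_blade)
qed

lemma Rn_plus_e_last:
  assumes "x \<in> Rn"
  shows "x + e_last \<in> span (range gen)" and "x + e_last \<noteq> 0"
proof -
  show "x + e_last \<in> span (range gen)"
    using assms Rn_subset_vectors e_last_vector by (intro span_add) auto
  show "x + e_last \<noteq> 0"
    using assms e_last_notin_Rn subspace_neg[OF subspace_Rn]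
    by (metis add_eq_0_iff)
qed

lemma e_last_square: "e_last * e_last = (- 1 :: 'n::finite option clifford)"
  by (simp add: gen_def blade_mult blade_sign_def one_clifford_def)

text \<open>
  With \<open>v = x + e\<^bsub>n+1\<^esub>\<close> the first factor of \<open>C(x)\<close> is \<open>e\<^bsub>n+1\<^esub> v + 2\<close>, so that
  \<open>C(x) = e\<^bsub>n+1\<^esub> + 2 v\<^sup>-\<^sup>1\<close>.
\<close>

lemma cayley_diff_e_last:
  assumes "x \<in> Rn"
  shows "cayley x - e_last = (- 2 / (norm (x + e_last))\<^sup>2) *\<^sub>R (x + e_last)"
proof -
  define v where "v = x + e_last"
  have v: "v \<in> span (range gen)" "v \<noteq> 0"
    using Rn_plus_e_last[OF assms] by (simp_all add: v_def)
  have "e_last * x + 1 = e_last * v + 2 *\<^sub>R 1"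
    by (simp add: v_def distrib_left e_last_square scaleR_2)
  then have "cayley x = (e_last * v + 2 *\<^sub>R 1) * (- (v /\<^sub>R (norm v)\<^sup>2))"
    unfolding cayley_def using cl_inverse_vector[OF v] by (simp add: v_def)
  also have "\<dots> = - ((e_last * (v * v)) /\<^sub>R (norm v)\<^sup>2) - (2 / (norm v)\<^sup>2) *\<^sub>R v"
    by (simp add: distrib_right mult.assoc divide_inverse scaleR_add_right)
  also have "\<dots> = e_last - (2 / (norm v)\<^sup>2) *\<^sub>R v"
    using v by (simp add: vector_square)
  finally show ?thesis
    by (simp add: v_def)
qed

lemma cayley_inv_cayley:
  assumes "x \<in> Rn"
  shows "cayley_inv (cayley x) = x"
proof -
  define v where "v = x + e_last"
  define N where "N = (norm v)\<^sup>2"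
  have v: "v \<in> span (range gen)" "v \<noteq> 0"
    using Rn_plus_e_last[OF assms] by (simp_all add: v_def)
  have vv: "v * v = - (N *\<^sub>R 1)" and N: "N \<noteq> 0"
    using v by (simp_all add: N_def vector_square)
  have diff: "cayley x - e_last = (- 2 / N) *\<^sub>R v"
    using cayley_diff_e_last[OF assms] by (simp add: v_def N_def)
  then have inv: "cl_inverse (cayley x - e_last) = (1 / 2) *\<^sub>R v"
    using N by (intro cl_inverse_eqI) (simp_all add: vv)
  have "cayley x = e_last + (- 2 / N) *\<^sub>R v"
    using diff by (simp add: algebra_simps)
  then have "- e_last * cayley x + 1 = 2 *\<^sub>R 1 + (2 / N) *\<^sub>R (e_last * v)"
    by (simp add: right_diff_distrib e_last_square scaleR_2)
  then have "cayley_inv (cayley x) = (2 *\<^sub>R 1 + (2 / N) *\<^sub>R (e_last * v)) * ((1 / 2) *\<^sub>R v)"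
    by (simp only: cayley_inv_def inv)
  also have "\<dots> = v + (1 / N) *\<^sub>R (e_last * (v * v))"
    by (simp add: distrib_right mult.assoc scaleR_add_right)
  also have "\<dots> = v - e_last"
    using N by (simp add: vv)
  also have "\<dots> = x"
    by (simp add: v_def)
  finally show ?thesis .
qed

theorem theorem2:
  fixes k :: nat
    and U :: "'n::finite option clifford set"
    and g :: "'n option clifford \<Rightarrow> 'n option clifford \<Rightarrow> 'n option clifford"
  assumes "openin (top_of_set Rn) U" and "connected U" and "U \<noteq> {}"
    and "\<And>x. x \<in> U \<Longrightarrow> (\<lambda>u\<in>Rn. g x u) \<in> monogenic_polys Rn k"
    and "xs \<in> cayley ` U"
    and "a = (xs - e_last) /\<^sub>R norm (xs - e_last)"
    and "w \<in> conj_Rn a"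
    and "u = ((xs - e_last) * w * (xs - e_last)) /\<^sub>R (norm (xs - e_last))\<^sup>2"
    and "x = cayley_inv xs"
  shows "fischer_proj (conj_Rn a) k
           (\<lambda>w\<in>conj_Rn a. cayley_J xs *
              g (cayley_inv xs)
                (((xs - e_last) * w * (xs - e_last)) /\<^sub>R (norm (xs - e_last))\<^sup>2)) w
         = cayley_J xs * fischer_proj Rn k (\<lambda>u\<in>Rn. g x u) u"
proof -
  define r where "r = norm (xs - e_last)"
  obtain y where y: "y \<in> U" "xs = cayley y"
    using assms(5) by auto
  have yR: "y \<in> Rn"
    using y(1) openin_imp_subset[OF assms(1)] by auto
  have xy: "x = y"
    using assms(9) y(2) cayley_inv_cayley[OF yR] by simp
  have diff: "xs - e_last = (- 2 / (norm (y + e_last))\<^sup>2) *\<^sub>R (y + e_last)"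
    using cayley_diff_e_last[OF yR] y(2) by simp
  have vec: "xs - e_last \<in> span (range gen)"
    unfolding diff using Rn_plus_e_last(1)[OF yR] by (rule span_scale)
  have r: "r \<noteq> 0"
    unfolding r_def diff using Rn_plus_e_last(2)[OF yR] by simp
  have a: "a \<in> span (range gen)" "norm a = 1"
    using vec r by (auto simp: assms(6) r_def intro: span_scale)
  have xs_a: "xs - e_last = r *\<^sub>R a"
    using r by (simp add: assms(6) r_def)
  have J: "cayley_J xs = (r / r ^ CARD('n)) *\<^sub>R a"
    unfolding cayley_J_def r_def[symmetric] unfolding xs_a by (simp add: divide_inverse mult.commute)
  have arg: "((xs - e_last) * v * (xs - e_last)) /\<^sub>R (norm (xs - e_last))\<^sup>2 = a * v * a" for v
    unfolding r_def[symmetric] unfolding xs_a using r by (simp add: power2_eq_square field_simps)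
  define f where "f = (\<lambda>u\<in>Rn. g x u)"
  have f: "f \<in> monogenic_polys Rn k"
    unfolding f_def xy using y(1) by (rule assms(4))
  have K: "conj_Rn a = {w \<in> span (range gen). a * w * a \<in> Rn}"
    by (simp add: conj_Rn_def Rn1_def)
  define F where "F = (\<lambda>w\<in>conj_Rn a. cayley_J xs * f (a * w * a))"
  have F: "F \<in> monogenic_polys (conj_Rn a) k"
    unfolding F_def K J by (rule monogenic_polys_conj[OF a subspace_Rn Rn_subset_vectors f])
  have "(\<lambda>w\<in>conj_Rn a. cayley_J xs *
      g (cayley_inv xs) (((xs - e_last) * w * (xs - e_last)) /\<^sub>R (norm (xs - e_last))\<^sup>2)) = F"
    unfolding F_def arg assms(9)[symmetric] by (auto simp: f_def conj_Rn_def)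
  moreover have "fischer_proj (conj_Rn a) k F = F"
    using F by (intro fischer_proj_monogenic) (auto simp: K subspace_conj_vimage[OF subspace_Rn])
  moreover have "fischer_proj Rn k f = f"
    by (rule fischer_proj_monogenic[OF subspace_Rn Rn_subset_vectors f])
  moreover have "F w = cayley_J xs * f u"
    using assms(7,8) by (simp add: F_def arg)
  ultimately show ?thesis
    by (simp add: f_def)
qed

end
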